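(* Let $N=2^n$ and let $\mathsf H\in\mathbb R^{N\times N}$ be a time-independent real symmetric matrix (Hamiltonian). Then the quantum system with Hamiltonian $\mathsf H$ can be analogously simulated with a decoupled second-order linear dynamical system (in the sense defined in the context). That is, there exist real symmetric positive semidefinite matrices $\mathsf S_1,\mathsf S_2\in\mathbb R^{N\times N}$, independent of the initial state, such that with $\mathsf S=\mathsf S_1\oplus\mathsf S_2$, for every initial state $\psi(0)\in\mathbb C^N$ with $\|\psi(0)\|=1$, if $\psi(t)$ denotes the solution of $\dot\psi(t)=-i\mathsf H\psi(t)$ with this initial state and $\varphi(t)=\begin{bmatrix}\operatorname{Re}\psi(t)\\ \operatorname{Im}\psi(t)\end{bmatrix}\in\mathbb R^{2N}$, then the initial value problem $$\ddot x(t)+\mathsf S x(t)=0,\qquad x(0)=\varphi(0),\qquad \dot x(0)=\dot\varphi(0)=-\begin{bmatrix}0&-\mathsf H\\ \mathsf H&0\end{bmatrix}\varphi(0)$$ has a unique twice differentiable solution $x:[0,\infty)\to\mathbb R^{2N}$, and $x(t)=\varphi(t)$ for all $t\ge0$.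
   Context: A closed quantum system with time-independent Hamiltonian $\mathsf H$ evolves by the Schrödinger equation $\dot\psi(t)=-i\mathsf H\psi(t)$ ($\hbar=1$), where $\psi(t)\in\mathbb C^N$, $\|\psi(t)\|=1$. $\operatorname{Re}$ and $\operatorname{Im}$ are taken entrywise, and $\mathsf S_1\oplus\mathsf S_2$ denotes the block diagonal matrix with diagonal blocks $\mathsf S_1,\mathsf S_2$. The second-order linear dynamical systems used here are of the form $\ddot x(t)+\mathsf S x(t)=0$ with $\mathsf S$ (the stiffness matrix) constant, real symmetric and positive semidefinite. Such a system is decoupled if it can be separated into two subsystems with no stiffness connection between them, i.e. $\mathsf S=\mathsf S_1\oplus\mathsf S_2$; here the two subsystems consist of the first $N$ coordinates (encoding real parts of amplitudes) and the last $N$ coordinates (encoding imaginary parts). The quantum system is analogously simulated by such a system if $\mathsf S$ does not depend on the initial quantum state and, for every initial quantum state, the classical system started from the real encoding $\varphi(0)$ of the state and the velocity $\dot\varphi(0)$ prescribed by the Schrödinger equation at time $0$ has the real encoding $\varphi(t)$ of $\psi(t)$ as its unique trajectory. *)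

theory Defs
  imports "HOL-Analysis.Analysis"
begin

text \<open>
  The time domain is the half-line \<open>[0, \<infinity>)\<close>. Derivatives are taken within \<open>{0..}\<close>,
  i.e. two-sided for \<open>t > 0\<close> and one-sided at \<open>t = 0\<close>. Trajectories are total functions
  on the reals of which only the values on \<open>{0..}\<close> matter; accordingly, uniqueness of a
  trajectory means agreement on \<open>{0..}\<close>.
\<close>

text \<open>Coordinates of \<open>2N\<close>-dimensional real space are indexed by the sum type: \<open>Inl\<close> for the
  first \<open>N\<close> coordinates (real parts), \<open>Inr\<close> for the last \<open>N\<close> (imaginary parts).\<close>

definition block_matrix ::
  "real^'n^'n \<Rightarrow> real^'n^'n \<Rightarrow> real^'n^'n \<Rightarrow> real^'n^'n \<Rightarrow> real^('n + 'n)^('n + 'n)"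
  where "block_matrix A B C D = (\<chi> i j.
    case i of
      Inl k \<Rightarrow> (case j of Inl l \<Rightarrow> A $ k $ l | Inr l \<Rightarrow> B $ k $ l)
    | Inr k \<Rightarrow> (case j of Inl l \<Rightarrow> C $ k $ l | Inr l \<Rightarrow> D $ k $ l))"

definition direct_sum_matrix :: "real^'n^'n \<Rightarrow> real^'n^'n \<Rightarrow> real^('n + 'n)^('n + 'n)"
  where "direct_sum_matrix S1 S2 = block_matrix S1 0 0 S2"

definition real_encoding :: "complex^'n \<Rightarrow> real^('n + 'n)"
  where "real_encoding \<psi> = (\<chi> i. case i of Inl k \<Rightarrow> Re (\<psi> $ k) | Inr k \<Rightarrow> Im (\<psi> $ k))"

definition symmetric_matrix :: "real^'m^'m \<Rightarrow> bool"
  where "symmetric_matrix A \<longleftrightarrow> transpose A = A"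

definition positive_semidefinite :: "real^'m^'m \<Rightarrow> bool"
  where "positive_semidefinite A \<longleftrightarrow> (\<forall>x. 0 \<le> x \<bullet> (A *v x))"

definition schroedinger_solution ::
  "real^'n^'n \<Rightarrow> complex^'n \<Rightarrow> (real \<Rightarrow> complex^'n) \<Rightarrow> bool"
  where "schroedinger_solution H \<psi>0 \<psi> \<longleftrightarrow>
    \<psi> 0 = \<psi>0 \<and>
    (\<forall>t\<ge>0. (\<psi> has_vector_derivative (- \<i>) *s (map_matrix complex_of_real H *v \<psi> t)) (at t within {0..}))"

definition second_order_solution ::
  "real^'m^'m \<Rightarrow> real^'m \<Rightarrow> real^'m \<Rightarrow> (real \<Rightarrow> real^'m) \<Rightarrow> bool"
  where "second_order_solution S x0 v0 x \<longleftrightarrow>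
    x 0 = x0 \<and>
    (\<exists>v a. v 0 = v0 \<and>
      (\<forall>t\<ge>0. (x has_vector_derivative v t) (at t within {0..}) \<and>
              (v has_vector_derivative a t) (at t within {0..}) \<and>
              a t + S *v x t = 0))"

text \<open>
  The existence conjunct only records that ``the solution'' of the Schroedinger equation is
  meaningful, so that the quantification over all its solutions is not vacuous.
  The conjunct on the derivative of \<open>\<phi>\<close> states that the initial velocity
  \<open>- [0, -H; H, 0] \<phi>(0)\<close> is the one prescribed by the Schroedinger equation.
\<close>

definition analogously_simulates :: "real^('n + 'n)^('n + 'n) \<Rightarrow> real^'n^'n \<Rightarrow> bool"
  where "analogously_simulates S H \<longleftrightarrow>
    (\<forall>\<psi>0. norm \<psi>0 = 1 \<longrightarrow>
      (\<exists>\<psi>. schroedinger_solution H \<psi>0 \<psi>) \<and>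
      (\<forall>\<psi>. schroedinger_solution H \<psi>0 \<psi> \<longrightarrow>
        (let \<phi> = (\<lambda>t. real_encoding (\<psi> t));
             v0 = - (block_matrix 0 (- H) H 0 *v \<phi> 0)
         in (\<phi> has_vector_derivative v0) (at 0 within {0..}) \<and>
            (\<exists>x. second_order_solution S (\<phi> 0) v0 x \<and>
                 (\<forall>y. second_order_solution S (\<phi> 0) v0 y \<longrightarrow> (\<forall>t\<ge>0. y t = x t)) \<and>
                 (\<forall>t\<ge>0. x t = \<phi> t)))))"

end

theory Submission
  imports Defs
begin

text \<open>
  In real coordinates the Schroedinger equation is \<open>\<phi>' = J \<phi>\<close> with \<open>J = - [0, -H; H, 0]\<close>.
  Differentiating once more gives \<open>\<phi>'' = J (J \<phi>)\<close>, and \<open>J (J \<phi>) = - (H\<^sup>2 \<oplus> H\<^sup>2) \<phi>\<close> is block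
  diagonal, so \<open>S1 = S2 = H\<^sup>2\<close> works. Uniqueness follows from conservation of the
  energy \<open>v \<bullet> v + x \<bullet> (S x)\<close>, and the Schroedinger equation is solved by the exponential series.
\<close>

section \<open>Linear ordinary differential equations\<close>

lemma norm_funpow_le:
  fixes f :: "'a::real_normed_vector \<Rightarrow> 'a"
  assumes "0 \<le> K" "\<And>x. norm (f x) \<le> norm x * K"
  shows "norm ((f ^^ k) x) \<le> norm x * K ^ k"
proof (induction k)
  case (Suc k)
  have "norm ((f ^^ Suc k) x) \<le> norm ((f ^^ k) x) * K"
    using assms(2) by simp
  also have "\<dots> \<le> norm x * K ^ k * K"
    by (intro mult_right_mono Suc assms(1))
  finally show ?case by (simp add: mult_ac)
qed simp

text \<open>The solution is \<open>exp (t f) x0\<close>, written as the power series with terms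
  \<open>T t k\<close>. Pairing it with a fixed vector \<open>b\<close> turns it into a scalar power
  series that converges for every real argument, so termwise differentiation applies coordinate by
  coordinate.\<close>

lemma linear_ode_exists:
  fixes f :: "'a::euclidean_space \<Rightarrow> 'a"
  assumes "bounded_linear f"
  shows "\<exists>x. x 0 = x0 \<and> (\<forall>t. (x has_vector_derivative f (x t)) (at t))"
proof -
  interpret f: bounded_linear f by fact
  obtain K where K: "0 \<le> K" "\<And>x. norm (f x) \<le> norm x * K"
    using f.nonneg_bounded by blast
  define T where "T t k = (t ^ k / fact k) *\<^sub>R (f ^^ k) x0" for t :: real and k
  define x where "x t = (\<Sum>k. T t k)" for t
  \<comment> \<open>The operator bound \<open>K\<close> gives the exponential series of
    \<open>\<bar>t\<bar> * K\<close>, scaled by \<open>norm x0\<close>, as majorant.\<close>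
  have summable_T: "summable (T t)" for t
  proof (rule summable_comparison_test')
    show "summable (\<lambda>k. norm x0 * (inverse (fact k) * (\<bar>t\<bar> * K) ^ k))"
      by (intro summable_mult summable_exp)
    show "norm (T t k) \<le> norm x0 * (inverse (fact k) * (\<bar>t\<bar> * K) ^ k)" for k
    proof -
      have "norm (T t k) = \<bar>t\<bar> ^ k / fact k * norm ((f ^^ k) x0)"
        by (simp add: T_def power_abs)
      also have "\<dots> \<le> \<bar>t\<bar> ^ k / fact k * (norm x0 * K ^ k)"
        by (intro mult_left_mono norm_funpow_le K) auto
      finally show ?thesis by (simp add: field_simps power_mult_distrib)
    qed
  qed
  have "((\<lambda>t. x t \<bullet> b) has_real_derivative f (x t) \<bullet> b) (at t)" for t b
  proof -
    define c where "c k = ((f ^^ k) x0 \<bullet> b) / fact k" for k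
    have c: "(\<lambda>k. T s k \<bullet> b) = (\<lambda>k. c k * s ^ k)" for s
      by (auto simp: T_def c_def)
    have sums_c: "(\<lambda>k. c k * s ^ k) sums (x s \<bullet> b)" for s
      using bounded_linear.sums[OF bounded_linear_inner_left summable_sums[OF summable_T], of s b]
      by (simp add: c x_def)
    \<comment> \<open>Applying \<open>f\<close> raises the iterate from \<open>k\<close> to
      \<open>Suc k\<close>; the factor \<open>Suc k\<close> in \<open>diffs\<close> turns
      \<open>fact (Suc k)\<close> back into \<open>fact k\<close>. Hence \<open>f\<close> acts on
      the series as termwise differentiation.\<close>
    have "f (T t k) \<bullet> b = diffs c k * t ^ k" for k
      by (simp add: T_def c_def diffs_def f.scaleR del: of_nat_Suc)
    moreover have "(\<lambda>k. f (T t k) \<bullet> b) sums (f (x t) \<bullet> b)"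
      unfolding x_def
      by (intro bounded_linear.sums[OF bounded_linear_inner_left] f.sums summable_sums summable_T)
    ultimately have "(\<Sum>k. diffs c k * t ^ k) = f (x t) \<bullet> b"
      by (simp add: sums_iff)
    moreover have "((\<lambda>s. \<Sum>k. c k * s ^ k) has_real_derivative (\<Sum>k. diffs c k * t ^ k)) (at t)"
      using sums_c by (intro termdiffs_strong_converges_everywhere) (auto simp: sums_iff)
    ultimately show ?thesis
      using sums_c by (simp add: sums_iff)
  qed
  then have "(x has_vector_derivative f (x t)) (at t)" for t
    unfolding has_vector_derivative_def
    by (subst has_derivative_componentwise_within)
      (auto simp: has_field_derivative_def mult_commute_abs)
  \<comment> \<open>Since \<open>0 ^ 0 = 1\<close>, the constant term survives at time 0.\<close>
  moreover have "T 0 k = (if k = 0 then x0 else 0)" for k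
    by (auto simp: T_def)
  then have "T 0 = (\<lambda>k. if k = 0 then x0 else 0)" by auto
  then have "x 0 = x0"
    using sums_single[of 0 "\<lambda>_. x0"] by (simp add: x_def sums_iff)
  ultimately show ?thesis by blast
qed

lemma symmetric_matrix_inner:
  assumes "symmetric_matrix A"
  shows "x \<bullet> (A *v y) = (A *v x) \<bullet> y"
  using assms dot_lmul_matrix[of x A y]
  by (metis symmetric_matrix_def vector_transpose_matrix)

text \<open>The difference of two solutions solves the same equation with zero initial data. Its
  energy is conserved, hence zero, and as both summands are nonnegative its velocity
  vanishes.\<close>

lemma second_order_solution_unique:
  fixes S :: "real^'m^'m"
  assumes sym: "symmetric_matrix S" and psd: "positive_semidefinite S"
    and x: "second_order_solution S x0 v0 x" and y: "second_order_solution S x0 v0 y"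
    and "0 \<le> t"
  shows "y t = x t"
proof -
  obtain v a where v: "x 0 = x0" "v 0 = v0"
    "\<And>t. 0 \<le> t \<Longrightarrow> (x has_vector_derivative v t) (at t within {0..})"
    "\<And>t. 0 \<le> t \<Longrightarrow> (v has_vector_derivative a t) (at t within {0..})"
    "\<And>t. 0 \<le> t \<Longrightarrow> a t + S *v x t = 0"
    using x unfolding second_order_solution_def by blast
  obtain w b where w: "y 0 = x0" "w 0 = v0"
    "\<And>t. 0 \<le> t \<Longrightarrow> (y has_vector_derivative w t) (at t within {0..})"
    "\<And>t. 0 \<le> t \<Longrightarrow> (w has_vector_derivative b t) (at t within {0..})"
    "\<And>t. 0 \<le> t \<Longrightarrow> b t + S *v y t = 0"
    using y unfolding second_order_solution_def by blast
  define d where "d t = y t - x t" for t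
  define u where "u t = w t - v t" for t
  have d': "(d has_vector_derivative u t) (at t within {0..})" if "0 \<le> t" for t
    unfolding d_def u_def using that by (intro has_vector_derivative_diff v w)
  have u': "(u has_vector_derivative - (S *v d t)) (at t within {0..})" if "0 \<le> t" for t
  proof -
    have "b t - a t = - (S *v d t)"
      using v(5)[OF that] w(5)[OF that]
      by (simp add: d_def matrix_vector_mult_diff_distrib flip: eq_neg_iff_add_eq_0)
    then show ?thesis
      unfolding u_def using has_vector_derivative_diff[OF w(4)[OF that] v(4)[OF that]] by simp
  qed
  have Sd': "((\<lambda>t. S *v d t) has_vector_derivative S *v u t) (at t within {0..})" if "0 \<le> t" for t
    by (intro bounded_linear.has_vector_derivative[OF matrix_vector_mul_bounded_linear] d' that)
  \<comment> \<open>Twice the mechanical energy: kinetic plus potential part.\<close>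
  define E where "E t = u t \<bullet> u t + d t \<bullet> (S *v d t)" for t
  have E': "(E has_vector_derivative 0) (at t within {0..})" if "0 \<le> t" for t
  proof -
    have "(E has_vector_derivative
        (u t \<bullet> (- (S *v d t)) + (- (S *v d t)) \<bullet> u t) + (d t \<bullet> (S *v u t) + u t \<bullet> (S *v d t)))
        (at t within {0..})"
      unfolding E_def
      by (intro has_vector_derivative_add
          bounded_bilinear.has_vector_derivative[OF bounded_bilinear_inner] u' d' Sd' that)
    \<comment> \<open>Symmetry of \<open>S\<close> makes the two potential terms equal, and they
      cancel the two kinetic ones.\<close>
    then show ?thesis
      using symmetric_matrix_inner[OF sym, of "d t" "u t"] by (simp add: inner_commute)
  qed
  have u0: "u t = 0" if "0 \<le> t" for t
  proof -
    obtain c where "\<And>t. t \<in> {0..} \<Longrightarrow> E t = c"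
      using has_vector_derivative_zero_constant[of "{0..}" E] E' by auto
    moreover have "E 0 = 0"
      using v(1,2) w(1,2) by (simp add: E_def u_def d_def)
    ultimately have "E t = 0" using that by force
    moreover have "0 \<le> d t \<bullet> (S *v d t)"
      using psd by (simp add: positive_semidefinite_def)
    ultimately have "u t \<bullet> u t \<le> 0" by (simp add: E_def)
    then show ?thesis by (metis inner_eq_zero_iff inner_ge_zero order_antisym)
  qed
  \<comment> \<open>\<open>S\<close> may be singular, so zero potential energy does not force
    \<open>d t = 0\<close>. Instead \<open>d\<close> is constant because its velocity is zero, and
    it starts at 0.\<close>
  obtain c where "\<And>t. t \<in> {0..} \<Longrightarrow> d t = c"
    using has_vector_derivative_zero_constant[of "{0..}" d] d' u0 by auto
  then have "d t = d 0" using \<open>0 \<le> t\<close> by force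
  then show ?thesis using v(1) w(1) by (simp add: d_def)
qed

section \<open>Block matrices\<close>

lemma sum_UNIV_sum_type:
  "(\<Sum>i\<in>UNIV. f i) = (\<Sum>k\<in>UNIV. f (Inl k)) + (\<Sum>k\<in>UNIV. f (Inr k))"
  for f :: "'a::finite + 'b::finite \<Rightarrow> 'c::comm_monoid_add"
  by (simp add: UNIV_Plus_UNIV[symmetric] sum.Plus del: UNIV_Plus_UNIV)

lemma block_matrix_mult_vec:
  "block_matrix A B C D *v x = (\<chi> i. case i of
      Inl k \<Rightarrow> (A *v (\<chi> l. x $ Inl l) + B *v (\<chi> l. x $ Inr l)) $ k
    | Inr k \<Rightarrow> (C *v (\<chi> l. x $ Inl l) + D *v (\<chi> l. x $ Inr l)) $ k)"
  by (auto simp: vec_eq_iff block_matrix_def matrix_vector_mult_def sum_UNIV_sum_type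
      split: sum.split)

lemma symmetric_direct_sum_matrix:
  "symmetric_matrix A \<Longrightarrow> symmetric_matrix B \<Longrightarrow> symmetric_matrix (direct_sum_matrix A B)"
  by (auto simp: symmetric_matrix_def direct_sum_matrix_def block_matrix_def transpose_def
      vec_eq_iff split: sum.split)

lemma positive_semidefinite_direct_sum_matrix:
  fixes A B :: "real^'a^'a"
  assumes "positive_semidefinite A" "positive_semidefinite B"
  shows "positive_semidefinite (direct_sum_matrix A B)"
  unfolding positive_semidefinite_def
proof
  fix x :: "real^('a + 'a)"
  let ?l = "\<chi> k. x $ Inl k" and ?r = "\<chi> k. x $ Inr k"
  have "x \<bullet> (direct_sum_matrix A B *v x) = ?l \<bullet> (A *v ?l) + ?r \<bullet> (B *v ?r)"
    by (simp add: direct_sum_matrix_def block_matrix_mult_vec inner_vec_def sum_UNIV_sum_type)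
  then show "0 \<le> x \<bullet> (direct_sum_matrix A B *v x)"
    using assms by (simp add: positive_semidefinite_def)
qed

lemma symmetric_matrix_square:
  "symmetric_matrix A \<Longrightarrow> symmetric_matrix (A ** A)"
  by (simp add: symmetric_matrix_def matrix_transpose_mul)

text \<open>By self-adjointness the quadratic form of \<open>A ** A\<close> at \<open>x\<close> is
  the squared norm of \<open>A *v x\<close>.\<close>

lemma positive_semidefinite_square:
  "symmetric_matrix A \<Longrightarrow> positive_semidefinite (A ** A)"
  by (metis positive_semidefinite_def symmetric_matrix_inner matrix_vector_mul_assoc inner_ge_zero)

text \<open>This is where the decoupling arises: the matrix exchanges the real and imaginary halves,
  so applying it twice returns each half to its own place, with \<open>- (H ** H)\<close> acting on
  it.\<close>

lemma block_matrix_skew_square: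
  "block_matrix 0 (- H) H 0 *v (block_matrix 0 (- H) H 0 *v x) =
    - (direct_sum_matrix (H ** H) (H ** H) *v x)"
proof -
  have "(- H) *v z = - (H *v z)" for z
    by (simp add: vec_eq_iff matrix_vector_mult_def sum_negf)
  then show ?thesis
    by (simp add: direct_sum_matrix_def block_matrix_mult_vec vec_eq_iff
        flip: matrix_vector_mul_assoc split: sum.split)
      (simp add: vec_lambda_eta mult_minus_right matrix_vector_mult_def sum_negf)
qed

section \<open>The Schroedinger equation in real coordinates\<close>

lemma bounded_linear_real_encoding: "bounded_linear real_encoding"
  unfolding linear_conv_bounded_linear[symmetric]
  by (rule linearI) (auto simp: real_encoding_def vec_eq_iff split: sum.split)

text \<open>As \<open>H\<close> has real entries, it acts separately on real and imaginary parts,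
  and the factor \<open>- \<i>\<close> sends the pair (Re, Im) to (Im, -Re).\<close>

lemma real_encoding_schroedinger:
  "real_encoding ((- \<i>) *s (map_matrix complex_of_real H *v \<psi>)) =
    - (block_matrix 0 (- H) H 0 *v real_encoding \<psi>)"
  unfolding block_matrix_mult_vec
  by (auto simp: vec_eq_iff real_encoding_def matrix_vector_mult_def map_matrix_def sum_negf
      split: sum.split)

lemma schroedinger_solution_exists: "\<exists>\<psi>. schroedinger_solution H \<psi>0 \<psi>"
proof -
  \<comment> \<open>Linearity is over the reals: complex vectors are treated as a real Euclidean
    space, and the solution on the whole line is then restricted to \<open>{0..}\<close>.\<close>
  have "bounded_linear (\<lambda>\<psi>. (- \<i>) *s (map_matrix complex_of_real H *v \<psi>))"
    unfolding linear_conv_bounded_linear[symmetric]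
    by (rule linearI)
      (simp_all add: vec_eq_iff matrix_vector_mult_def algebra_simps sum.distrib
        scaleR_sum_right sum_distrib_left)
  then show ?thesis
    using linear_ode_exists[of _ \<psi>0] unfolding schroedinger_solution_def
    by (meson has_vector_derivative_at_within)
qed

lemma has_vector_derivative_real_encoding:
  assumes "schroedinger_solution H \<psi>0 \<psi>" "0 \<le> t"
  shows "((\<lambda>t. real_encoding (\<psi> t)) has_vector_derivative
    - (block_matrix 0 (- H) H 0 *v real_encoding (\<psi> t))) (at t within {0..})"
  using assms bounded_linear.has_vector_derivative[OF bounded_linear_real_encoding]
  unfolding schroedinger_solution_def by (metis real_encoding_schroedinger)

lemma second_order_solution_real_encoding:
  assumes "schroedinger_solution H \<psi>0 \<psi>"
  shows "second_order_solution (direct_sum_matrix (H ** H) (H ** H)) (real_encoding (\<psi> 0))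
    (- (block_matrix 0 (- H) H 0 *v real_encoding (\<psi> 0))) (\<lambda>t. real_encoding (\<psi> t))"
proof -
  let ?B = "block_matrix 0 (- H) H 0" and ?\<phi> = "\<lambda>t. real_encoding (\<psi> t)"
  let ?S = "direct_sum_matrix (H ** H) (H ** H)"
  have "((\<lambda>t. - (?B *v ?\<phi> t)) has_vector_derivative - (?S *v ?\<phi> t)) (at t within {0..})"
    if "0 \<le> t" for t
  proof -
    have "((\<lambda>t. - (?B *v ?\<phi> t)) has_vector_derivative - (?B *v - (?B *v ?\<phi> t))) (at t within {0..})"
      by (intro has_vector_derivative_minus has_vector_derivative_real_encoding[OF assms that]
          bounded_linear.has_vector_derivative[OF matrix_vector_mul_bounded_linear])
    moreover have "?B *v - z = - (?B *v z)" for z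
      using matrix_vector_mult_diff_distrib[of ?B 0 z] by simp
    ultimately show ?thesis by (simp add: block_matrix_skew_square)
  qed
  then show ?thesis
    unfolding second_order_solution_def
    using has_vector_derivative_real_encoding[OF assms]
    \<comment> \<open>The witnesses are the velocity given by the first-order equation and its
      derivative.\<close>
    by (intro conjI exI[of _ "\<lambda>t. - (?B *v ?\<phi> t)"] exI[of _ "\<lambda>t. - (?S *v ?\<phi> t)"]) auto
qed

theorem corollary1p1:
  fixes n :: nat and H :: "real^'q^'q"
  assumes "CARD('q) = 2 ^ n"
    and "symmetric_matrix H"
  shows "\<exists>S1 S2 :: real^'q^'q.
    symmetric_matrix S1 \<and> positive_semidefinite S1 \<and>
    symmetric_matrix S2 \<and> positive_semidefinite S2 \<and>
    analogously_simulates (direct_sum_matrix S1 S2) H"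
proof -
  note sq = symmetric_matrix_square[OF assms(2)] positive_semidefinite_square[OF assms(2)]
  let ?S = "direct_sum_matrix (H ** H) (H ** H)"
  have S: "symmetric_matrix ?S" "positive_semidefinite ?S"
    using sq by (auto intro: symmetric_direct_sum_matrix positive_semidefinite_direct_sum_matrix)
  have "analogously_simulates ?S H"
    unfolding analogously_simulates_def Let_def
  proof (intro allI impI conjI)
    fix \<psi>0 :: "complex^'q" and \<psi>
    assume \<psi>: "schroedinger_solution H \<psi>0 \<psi>"
    show "((\<lambda>t. real_encoding (\<psi> t)) has_vector_derivative
        - (block_matrix 0 (- H) H 0 *v real_encoding (\<psi> 0))) (at 0 within {0..})"
      using has_vector_derivative_real_encoding[OF \<psi>] by simp
    show "\<exists>x. second_order_solution ?S (real_encoding (\<psi> 0))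
          (- (block_matrix 0 (- H) H 0 *v real_encoding (\<psi> 0))) x \<and>
        (\<forall>y. second_order_solution ?S (real_encoding (\<psi> 0))
            (- (block_matrix 0 (- H) H 0 *v real_encoding (\<psi> 0))) y \<longrightarrow> (\<forall>t\<ge>0. y t = x t)) \<and>
        (\<forall>t\<ge>0. x t = real_encoding (\<psi> t))"
      \<comment> \<open>The encoded quantum trajectory is itself the classical solution
        \<open>x\<close>, so agreement with it is trivial and uniqueness does the rest.\<close>
      using second_order_solution_real_encoding[OF \<psi>] second_order_solution_unique[OF S]
      by (intro exI[of _ "\<lambda>t. real_encoding (\<psi> t)"]) blast
  qed (rule schroedinger_solution_exists)
  then show ?thesis using sq by blast
qed

end
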